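(* Let $X\subset\mathbb{R}^m$ and $Y\subset\mathbb{R}^n$ be nonempty, open and bounded, let $b\in C^4(\overline X\times\overline Y)$, let $c:\overline Y\to\mathbb{R}$, and let $y_\phi\in\overline Y$. If there is a point $x\in X$ such that $D_xb(x,\overline Y)=\{D_xb(x,y): y\in\overline Y\}\subseteq\mathbb{R}^m$ is not convex, then the set $U_{b,\phi}$ is not convex.
   Context: Here $m,n\ge 1$ are arbitrary. A price schedule is a function $v:\overline Y\to\mathbb{R}\cup\{+\infty\}$; its associated utility function is $v^b(x)=\sup_{y\in\overline Y}\big(b(x,y)-v(y)\big)$ for $x\in X$. A (finite-valued) function $X\to\mathbb{R}$ of the form $v^b$ is called $b$-convex, and $U_b$ is the set of all $b$-convex functions. Put $u_\phi(x)=b(x,y_\phi)-c(y_\phi)$. Then $U_{b,\phi}=\{u\in U_b: u(x)\ge u_\phi(x)\text{ for all }x\in X\}$. Convexity of $U_{b,\phi}$ means convexity as a subset of the vector space of real functions on $X$. $D_xb(x,y)\in\mathbb{R}^m$ denotes the gradient of $b$ in $x$. *)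

theory Defs
  imports "HOL-Analysis.Analysis"
begin

(* C^k up to the boundary of an open set S: f is continuous on the closure, is C^k in S, and every
   partial derivative of order at most k extends continuously to the closure. The witness g is the
   gradient on S; on the boundary of S it is that continuous extension. *)
primrec Ck_closure :: "nat \<Rightarrow> ('a::euclidean_space \<Rightarrow> real) \<Rightarrow> 'a set \<Rightarrow> bool" where
  "Ck_closure 0 f S \<longleftrightarrow> continuous_on (closure S) f"
| "Ck_closure (Suc k) f S \<longleftrightarrow> continuous_on (closure S) f \<and>
     (\<exists>g. (\<forall>z\<in>S. GDERIV f z :> g z) \<and> (\<forall>i\<in>Basis. Ck_closure k (\<lambda>z. g z \<bullet> i) S))"

(* Used only for x in an open set X and y in the closure of Y, where the gradient exists uniquely
   (see GDERIV_gradient_x), also when y is a boundary point. *)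
definition gradient_x :: "('a::euclidean_space \<times> 'b \<Rightarrow> real) \<Rightarrow> 'a \<Rightarrow> 'b \<Rightarrow> 'a" where
  "gradient_x b x y = (THE D. GDERIV (\<lambda>x'. b (x', y)) x :> D)"

definition price_schedule :: "'b::topological_space set \<Rightarrow> ('b \<Rightarrow> ereal) \<Rightarrow> bool" where
  "price_schedule Y v \<longleftrightarrow> (\<forall>y\<in>closure Y. v y \<noteq> -\<infinity>)"

definition b_transform ::
  "('a \<times> 'b::topological_space \<Rightarrow> real) \<Rightarrow> 'b set \<Rightarrow> ('b \<Rightarrow> ereal) \<Rightarrow> 'a \<Rightarrow> ereal" where
  "b_transform b Y v x = (SUP y\<in>closure Y. ereal (b (x, y)) - v y)"

(* Functions on X are represented by the elements of extensional X. *)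
definition U_b ::
  "('a \<times> 'b::topological_space \<Rightarrow> real) \<Rightarrow> 'a set \<Rightarrow> 'b set \<Rightarrow> ('a \<Rightarrow> real) set" where
  "U_b b X Y = {u \<in> extensional X.
     \<exists>v. price_schedule Y v \<and> (\<forall>x\<in>X. ereal (u x) = b_transform b Y v x)}"

definition u_phi :: "('a \<times> 'b \<Rightarrow> real) \<Rightarrow> ('b \<Rightarrow> real) \<Rightarrow> 'b \<Rightarrow> 'a \<Rightarrow> real" where
  "u_phi b c y\<phi> x = b (x, y\<phi>) - c y\<phi>"

definition U_b_phi ::
  "('a \<times> 'b::topological_space \<Rightarrow> real) \<Rightarrow> ('b \<Rightarrow> real) \<Rightarrow> 'b \<Rightarrow> 'a set \<Rightarrow> 'b set \<Rightarrow> ('a \<Rightarrow> real) set"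
where
  "U_b_phi b c y\<phi> X Y = {u \<in> U_b b X Y. \<forall>x\<in>X. u x \<ge> u_phi b c y\<phi> x}"

(* The library's "convex", unfolded for the vector space of real functions on X: the type of
   functions into the reals is not an instance of real_vector. *)
definition convex_functions :: "'a set \<Rightarrow> ('a \<Rightarrow> real) set \<Rightarrow> bool" where
  "convex_functions X U \<longleftrightarrow>
     (\<forall>u\<in>U. \<forall>w\<in>U. \<forall>s\<ge>0. \<forall>t\<ge>0. s + t = 1 \<longrightarrow> (\<lambda>x\<in>X. s * u x + t * w x) \<in> U)"

lemma Ck_closure_imp_continuous_on: "Ck_closure k f S \<Longrightarrow> continuous_on (closure S) f"
  by (cases k) auto

lemma GDERIV_unique:
  assumes "GDERIV f x :> D" "GDERIV f x :> E"
  shows "D = E"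
proof -
  have "(\<lambda>h. h \<bullet> D) = (\<lambda>h. h \<bullet> E)"
    using assms unfolding gderiv_def by (rule has_derivative_unique)
  then have "(D - E) \<bullet> D = (D - E) \<bullet> E" by metis
  then have "(D - E) \<bullet> (D - E) = 0" by (simp add: inner_diff_right)
  then show ?thesis by simp
qed

lemma GDERIV_gradient_x:
  fixes b :: "'a::euclidean_space \<times> 'b::euclidean_space \<Rightarrow> real"
  assumes X: "open X" "bounded X" and Y: "bounded Y"
    and b: "Ck_closure (Suc k) b (X \<times> Y)"
    and x: "x \<in> X" and y: "y \<in> closure Y"
  shows "GDERIV (\<lambda>x'. b (x', y)) x :> gradient_x b x y"
proof -
  obtain g where g: "\<And>z. z \<in> X \<times> Y \<Longrightarrow> GDERIV b z :> g z"
    and gi: "\<And>i. i \<in> Basis \<Longrightarrow> Ck_closure k (\<lambda>z. g z \<bullet> i) (X \<times> Y)"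
    using b by auto
  have "continuous_on (closure (X \<times> Y)) (\<lambda>z. \<Sum>i\<in>Basis. (g z \<bullet> i) *\<^sub>R i)"
    using Ck_closure_imp_continuous_on[OF gi] by (intro continuous_on_sum continuous_on_scaleR) simp_all
  then have "continuous_on (closure X \<times> closure Y) g"
    by (simp add: euclidean_representation closure_Times)
  then have uc: "uniformly_continuous_on (closure X \<times> closure Y) g"
    using X Y by (intro compact_uniformly_continuous compact_Times) auto
  have bc: "continuous_on (closure X \<times> closure Y) b"
    using Ck_closure_imp_continuous_on[OF b] by (simp add: closure_Times)
  obtain r where r: "r > 0" "ball x r \<subseteq> X" using X x open_contains_ball by metis
  obtain s where s: "\<And>n::nat. s n \<in> Y" "s \<longlonglongrightarrow> y"
    using y closure_sequential by metis
  define B where "B = ball x r"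
  have BX: "B \<subseteq> X" using r B_def by simp
  have sub: "w \<in> closure X" if "w \<in> B" for w using that BX closure_subset by blast
  have sY: "s n \<in> closure Y" for n using s closure_subset by blast
  have der: "((\<lambda>x'. b (x', s n)) has_derivative (\<lambda>h. h \<bullet> fst (g (w, s n)))) (at w within B)"
    if "w \<in> B" for n w
  proof -
    have "(b has_derivative (\<lambda>h. h \<bullet> g (w, s n))) (at (w, s n))"
      using g[of "(w, s n)"] that BX s by (auto simp: gderiv_def)
    moreover have "((\<lambda>x'. (x', s n)) has_derivative (\<lambda>h. (h, 0))) (at w within B)"
      by (auto intro!: derivative_eq_intros)
    ultimately have "((\<lambda>x'. b (x', s n)) has_derivative (\<lambda>h. (h, 0) \<bullet> g (w, s n))) (at w within B)"
      using has_derivative_compose[of "\<lambda>x'. (x', s n)" "\<lambda>h. (h, 0)" w B b "\<lambda>h. h \<bullet> g (w, s n)"] by simp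
    then show ?thesis by (simp add: inner_prod_def)
  qed
  have lim: "(\<lambda>n. b (w, s n)) \<longlonglongrightarrow> b (w, y)" if "w \<in> B" for w
  proof (rule continuous_on_tendsto_compose[OF bc])
    show "(\<lambda>n. (w, s n)) \<longlonglongrightarrow> (w, y)" using s by (intro tendsto_intros)
  qed (use sub[OF that] sY y in auto)
  have unif: "\<forall>\<^sub>F n in sequentially. \<forall>w\<in>B. \<forall>h.
      norm (h \<bullet> fst (g (w, s n)) - h \<bullet> fst (g (w, y))) \<le> e * norm h" if "e > 0" for e
  proof -
    obtain d where d: "d > 0" "\<And>z z'. z \<in> closure X \<times> closure Y \<Longrightarrow> z' \<in> closure X \<times> closure Y
        \<Longrightarrow> dist z' z < d \<Longrightarrow> dist (g z') (g z) < e"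
      using uc \<open>e > 0\<close> unfolding uniformly_continuous_on_def by metis
    have "\<forall>\<^sub>F n in sequentially. dist (s n) y < d" using s d by (simp add: tendsto_iff)
    then show ?thesis
    proof eventually_elim
      case (elim n)
      show ?case
      proof (intro ballI allI)
        fix w h :: 'a assume w: "w \<in> B"
        have "dist (w, s n) (w, y) < d" using elim by (simp add: dist_Pair_Pair)
        then have "dist (g (w, s n)) (g (w, y)) < e"
          by (intro d(2)) (simp_all add: sub[OF w] sY y)
        then have "dist (fst (g (w, s n))) (fst (g (w, y))) \<le> e"
          using dist_fst_le[of "g (w, s n)" "g (w, y)"] by linarith
        then have "norm h * norm (fst (g (w, s n)) - fst (g (w, y))) \<le> norm h * e"
          by (intro mult_left_mono) (auto simp: dist_norm)
        then show "norm (h \<bullet> fst (g (w, s n)) - h \<bullet> fst (g (w, y))) \<le> e * norm h"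
          using Cauchy_Schwarz_ineq2[of "h" "fst (g (w, s n)) - fst (g (w, y))"]
          by (simp add: inner_diff_right mult.commute)
      qed
    qed
  qed
  have xB: "x \<in> B" "open B" using r by (auto simp: B_def)
  have "\<exists>f. \<forall>w\<in>B. (\<lambda>n. b (w, s n)) \<longlonglongrightarrow> f w \<and> (f has_derivative (\<lambda>h. h \<bullet> fst (g (w, y)))) (at w within B)"
    using has_derivative_sequence[where S = B and f = "\<lambda>n w. b (w, s n)"
        and f' = "\<lambda>n w h. h \<bullet> fst (g (w, s n))" and g' = "\<lambda>w h. h \<bullet> fst (g (w, y))",
        OF _ der unif xB(1) lim[OF xB(1)]] convex_ball[of x r]
    unfolding B_def by blast
  then obtain f where f: "\<And>w. w \<in> B \<Longrightarrow> (\<lambda>n. b (w, s n)) \<longlonglongrightarrow> f w"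
    "\<And>w. w \<in> B \<Longrightarrow> (f has_derivative (\<lambda>h. h \<bullet> fst (g (w, y)))) (at w within B)" by blast
  have fb: "f w = b (w, y)" if "w \<in> B" for w
    using f(1)[OF that] lim[OF that] by (rule LIMSEQ_unique)
  have "(f has_derivative (\<lambda>h. h \<bullet> fst (g (x, y)))) (at x)"
    using f(2)[OF xB(1)] unfolding at_within_open[OF xB] .
  then have "((\<lambda>x'. b (x', y)) has_derivative (\<lambda>h. h \<bullet> fst (g (x, y)))) (at x)"
    by (rule has_derivative_transform_within_open[OF _ xB(2,1)]) (rule fb)
  then have "GDERIV (\<lambda>x'. b (x', y)) x :> fst (g (x, y))" by (simp add: gderiv_def)
  then show ?thesis unfolding gradient_x_def by (metis GDERIV_unique theI)
qed

end

theory Submission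
  imports Defs
begin

text \<open>
  If \<open>D\<^sub>xb(x\<^sub>0, y\<^sub>1)\<close> and \<open>D\<^sub>xb(x\<^sub>0, y\<^sub>2)\<close> have a convex combination \<open>p\<close>
  outside \<open>D\<^sub>xb(x\<^sub>0, closure Y)\<close>, then the same convex combination of the \<open>b\<close>-convex functions
  \<open>b(\<cdot>, y\<^sub>i) + k\<close>, with \<open>k\<close> large enough that they dominate \<open>u\<^sub>\<phi>\<close>, has gradient \<open>p\<close> at \<open>x\<^sub>0\<close>.
  By compactness of \<open>closure Y\<close>, a \<open>b\<close>-convex function \<open>u\<close> is touched from below at \<open>x\<^sub>0\<close> by some
  translate of \<open>b(\<cdot>, y)\<close>, so its gradient, where it exists, lies in \<open>D\<^sub>xb(x\<^sub>0, closure Y)\<close>.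
\<close>

text \<open>The price \<open>- k\<close> at \<open>y\<close> and \<infinity> at all other points
  makes every other term of the supremum -\<infinity>.\<close>

lemma slice_in_U_b:
  assumes "y \<in> closure Y"
  shows "(\<lambda>x\<in>X. b (x, y) + k) \<in> U_b b X Y"
proof -
  define v where "v = (\<lambda>y'. if y' = y then ereal (- k) else \<infinity>)"
  have "price_schedule Y v"
    by (simp add: price_schedule_def v_def)
  moreover have "ereal (b (x, y) + k) = b_transform b Y v x" for x
    unfolding b_transform_def
  proof (rule antisym)
    show "ereal (b (x, y) + k) \<le> (SUP y\<in>closure Y. ereal (b (x, y)) - v y)"
      using assms by (intro SUP_upper2[of y]) (simp_all add: v_def)
    show "(SUP y\<in>closure Y. ereal (b (x, y)) - v y) \<le> ereal (b (x, y) + k)"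
      by (intro SUP_least) (simp add: v_def)
  qed
  ultimately show ?thesis
    by (auto simp: U_b_def)
qed

text \<open>Since \<open>v\<close> need not be lower semicontinuous, the supremum at
  \<open>x0\<close> may not be attained. Near-maximizers support \<open>u\<close> up to an error
  \<open>e\<close>; eliminating \<open>v\<close> from this inequality leaves only terms continuous
  in \<open>y\<close>, so a limit point of near-maximizers gives exact support.\<close>

lemma U_b_supported:
  fixes b :: "'a \<times> 'b::euclidean_space \<Rightarrow> real"
  assumes Y: "bounded Y"
    and cont: "\<And>x. x \<in> X \<Longrightarrow> continuous_on (closure Y) (\<lambda>y. b (x, y))"
    and u: "u \<in> U_b b X Y" and x0: "x0 \<in> X"
  shows "\<exists>y\<in>closure Y. \<forall>x\<in>X. b (x, y) - b (x0, y) + u x0 \<le> u x"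
proof -
  obtain v where v: "price_schedule Y v" "\<And>x. x \<in> X \<Longrightarrow> ereal (u x) = b_transform b Y v x"
    using u by (auto simp: U_b_def)
  have approx: "\<exists>y\<in>closure Y. \<forall>x\<in>X. b (x, y) - b (x0, y) + (u x0 - e) \<le> u x" if "e > 0" for e
  proof -
    have "ereal (u x0 - e) < (SUP y\<in>closure Y. ereal (b (x0, y)) - v y)"
      unfolding b_transform_def[symmetric] v(2)[OF x0, symmetric] using that by simp
    then obtain y where y: "y \<in> closure Y" "ereal (u x0 - e) < ereal (b (x0, y)) - v y"
      by (auto simp: less_SUP_iff)
    \<comment> \<open>The strict lower bound excludes the price \<infinity>, and
      \<open>price_schedule\<close> excludes -\<infinity>.\<close>
    then obtain r where r: "v y = ereal r"
      using v(1) by (cases "v y") (auto simp: price_schedule_def)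
    have "b (x, y) - r \<le> u x" if "x \<in> X" for x
    proof -
      have "ereal (b (x, y)) - v y \<le> ereal (u x)"
        unfolding v(2)[OF that] b_transform_def using y(1) by (rule SUP_upper)
      then show ?thesis by (simp add: r)
    qed
    moreover have "u x0 - e < b (x0, y) - r"
      using y(2) by (simp add: r)
    ultimately show ?thesis
      using y(1) by (intro bexI[of _ y]) force+
  qed
  have "\<exists>y. y \<in> closure Y \<and> (\<forall>x\<in>X. b (x, y) - b (x0, y) + (u x0 - inverse (Suc n)) \<le> u x)"
    for n :: nat
    using approx[of "inverse (Suc n)"] by auto
  then obtain s where s: "\<And>n. s n \<in> closure Y"
    "\<And>n x. x \<in> X \<Longrightarrow> b (x, s n) - b (x0, s n) + (u x0 - inverse (Suc n)) \<le> u x"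
    by metis
  have "compact (closure Y)"
    using Y by simp
  then obtain y \<rho> where y: "y \<in> closure Y" "strict_mono \<rho>" "(s \<circ> \<rho>) \<longlonglongrightarrow> y"
    using s(1) unfolding compact_def by metis
  have lim: "(\<lambda>n. b (x, s (\<rho> n))) \<longlonglongrightarrow> b (x, y)" if "x \<in> X" for x
    by (rule continuous_on_tendsto_compose[OF cont[OF that]])
      (use y s(1) in \<open>auto simp: o_def\<close>)
  have "(\<lambda>n. inverse (real (Suc (\<rho> n)))) \<longlonglongrightarrow> 0"
    using LIMSEQ_subseq_LIMSEQ[OF LIMSEQ_inverse_real_of_nat y(2)] by (simp add: o_def)
  then have "(\<lambda>n. b (x, s (\<rho> n)) - b (x0, s (\<rho> n)) + (u x0 - inverse (Suc (\<rho> n))))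
      \<longlonglongrightarrow> b (x, y) - b (x0, y) + (u x0 - 0)" if "x \<in> X" for x
    by (intro tendsto_intros lim that x0)
  then have "b (x, y) - b (x0, y) + (u x0 - 0) \<le> u x" if "x \<in> X" for x
    by (rule LIMSEQ_le_const2) (use s(2) that in auto)
  then show ?thesis
    using y(1) by auto
qed

text \<open>The difference \<open>f - g\<close> attains its minimum over the open set
  \<open>X\<close> at \<open>x0\<close>, so its derivative vanishes there.\<close>

lemma GDERIV_eq_if_touches_below:
  fixes f g :: "'a::real_inner \<Rightarrow> real"
  assumes "open X" "x0 \<in> X" and "GDERIV f x0 :> p" "GDERIV g x0 :> q"
    and le: "\<And>x. x \<in> X \<Longrightarrow> g x - g x0 + f x0 \<le> f x"
  shows "p = q"
proof -
  have "((\<lambda>x. f x - g x) has_derivative (\<lambda>h. h \<bullet> p - h \<bullet> q)) (at x0)"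
    using assms(3,4) unfolding gderiv_def by (intro derivative_intros)
  then have "(\<lambda>h. h \<bullet> p - h \<bullet> q) = (\<lambda>h. 0)"
    using le by (intro differential_zero_maxmin[OF assms(2,1)]) force+
  \<comment> \<open>Evaluation at \<open>h = p - q\<close> yields the squared norm of
    \<open>p - q\<close>.\<close>
  then have "(p - q) \<bullet> p - (p - q) \<bullet> q = 0"
    by metis
  then show ?thesis
    by (simp flip: inner_diff_right)
qed

theorem proposition3p1:
  fixes X :: "(real ^ 'm) set" and Y :: "(real ^ 'n) set"
    and b :: "(real ^ 'm) \<times> (real ^ 'n) \<Rightarrow> real"
    and c :: "real ^ 'n \<Rightarrow> real" and y\<phi> :: "real ^ 'n"
  assumes "X \<noteq> {}" and "open X" and "bounded X"
    and "Y \<noteq> {}" and "open Y" and "bounded Y"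
    and "Ck_closure 4 b (X \<times> Y)"
    and "y\<phi> \<in> closure Y"
    and "\<exists>x\<in>X. \<not> convex {gradient_x b x y | y. y \<in> closure Y}"
  shows "\<not> convex_functions X (U_b_phi b c y\<phi> X Y)"
proof
  assume conv: "convex_functions X (U_b_phi b c y\<phi> X Y)"
  obtain x0 y1 y2 s t where x0: "x0 \<in> X" and y: "y1 \<in> closure Y" "y2 \<in> closure Y"
    and st: "s \<ge> 0" "t \<ge> 0" "s + t = 1"
    and notin: "s *\<^sub>R gradient_x b x0 y1 + t *\<^sub>R gradient_x b x0 y2
      \<notin> {gradient_x b x0 y | y. y \<in> closure Y}"
    using assms(9) unfolding convex_def by blast
  have cont: "continuous_on (closure X \<times> closure Y) b"
    using Ck_closure_imp_continuous_on[OF assms(7)] by (simp add: closure_Times)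
  have "compact (b ` (closure X \<times> closure Y))"
    using assms(3,6) by (intro compact_continuous_image cont compact_Times) auto
  then have "bounded (b ` (closure X \<times> closure Y))"
    by (rule compact_imp_bounded)
  then obtain M where M: "\<And>x y. x \<in> closure X \<Longrightarrow> y \<in> closure Y \<Longrightarrow> \<bar>b (x, y)\<bar> \<le> M"
    unfolding bounded_iff by force
  have XcX: "x \<in> closure X" if "x \<in> X" for x
    using that closure_subset by blast
  \<comment> \<open>With \<bar>\<open>b\<close>\<bar> bounded by \<open>M\<close>, this gives
    \<open>b (x, y) + k \<ge> M - c y\<phi> \<ge> b (x, y\<phi>) - c y\<phi>\<close> for all
    \<open>y\<close> in the closure at once.\<close>
  define k where "k = 2 * M - c y\<phi>"
  have slice: "(\<lambda>x\<in>X. b (x, y) + k) \<in> U_b_phi b c y\<phi> X Y" if "y \<in> closure Y" for y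
  proof -
    have "u_phi b c y\<phi> x \<le> b (x, y) + k" if "x \<in> X" for x
      using M[OF XcX[OF that] assms(8)] M[OF XcX[OF that] \<open>y \<in> closure Y\<close>]
      by (simp add: u_phi_def k_def)
    then show ?thesis
      using slice_in_U_b[OF that] by (simp add: U_b_phi_def)
  qed
  \<comment> \<open>Left unrestricted, so that the derivative rules apply directly; on
    \<open>X\<close> it agrees with the convex combination.\<close>
  define u where "u = (\<lambda>x. s * (b (x, y1) + k) + t * (b (x, y2) + k))"
  have "(\<lambda>x\<in>X. s * (\<lambda>x\<in>X. b (x, y1) + k) x + t * (\<lambda>x\<in>X. b (x, y2) + k) x)
      \<in> U_b_phi b c y\<phi> X Y"
    using conv slice[OF y(1)] slice[OF y(2)] st unfolding convex_functions_def by blast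
  also have "(\<lambda>x\<in>X. s * (\<lambda>x\<in>X. b (x, y1) + k) x + t * (\<lambda>x\<in>X. b (x, y2) + k) x) = restrict u X"
    by (auto simp: u_def restrict_def)
  finally have u: "restrict u X \<in> U_b b X Y"
    unfolding U_b_phi_def by blast
  have "continuous_on (closure Y) (\<lambda>y. b (x, y))" if "x \<in> X" for x
    by (rule continuous_on_compose2[OF cont]) (auto intro!: continuous_intros XcX[OF that])
  from U_b_supported[OF assms(6) this u x0] x0
  obtain y where yY: "y \<in> closure Y"
    and supp: "\<And>x. x \<in> X \<Longrightarrow> b (x, y) - b (x0, y) + u x0 \<le> u x"
    by auto
  \<comment> \<open>This covers boundary points of \<open>Y\<close>, where \<open>y1\<close>,
    \<open>y2\<close> and the supporting \<open>y\<close> may lie.\<close>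
  have grad: "GDERIV (\<lambda>x. b (x, y)) x0 :> gradient_x b x0 y" if "y \<in> closure Y" for y
    using assms(7) that
    by (intro GDERIV_gradient_x[OF assms(2,3,6) _ x0, where k = 3]) (simp_all add: eval_nat_numeral)
  have "GDERIV u x0 :> s *\<^sub>R gradient_x b x0 y1 + t *\<^sub>R gradient_x b x0 y2"
    using grad[OF y(1)] grad[OF y(2)] unfolding gderiv_def u_def
    by (auto intro!: derivative_eq_intros simp: inner_add_right)
  then have "s *\<^sub>R gradient_x b x0 y1 + t *\<^sub>R gradient_x b x0 y2 = gradient_x b x0 y"
    using grad[OF yY] supp by (rule GDERIV_eq_if_touches_below[OF assms(2) x0])
  then show False
    using notin yY by auto
qed

end
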